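(* Let $n\ge 2$ and let $S\subseteq\{1,\ldots,v\}^n$ be a subset of cardinality $vk$. There exists a $(v,k,\lambda)$ projection $n$-cube $C$ such that $S=\overline{C}$ if and only if the following statements are true for all $1\le x<y\le n$: (1) for all $i\in\{1,\ldots,v\}$, there are exactly $k$ elements $j\in\{1,\ldots,v\}$ such that $(i,j)\in\Pi_{xy}(S)$; (2) for all $j\in\{1,\ldots,v\}$, there are exactly $k$ elements $i\in\{1,\ldots,v\}$ such that $(i,j)\in\Pi_{xy}(S)$; (3) for all $i,i'\in\{1,\ldots,v\}$ with $i\neq i'$, there are exactly $\lambda$ elements $j\in\{1,\ldots,v\}$ such that $(i,j)\in\Pi_{xy}(S)$ and $(i',j)\in\Pi_{xy}(S)$.
   Context: A symmetric $(v,k,\lambda)$ design is identified with its incidence matrix: it is a $v\times v$ matrix $A$ with entries in $\{0,1\}$ satisfying $A A^t=(k-\lambda)I+\lambda J$, where $I$ is the identity matrix and $J$ the all-ones matrix; as in the usual definition of symmetric block designs, every column of $A$ also contains exactly $k$ ones (this is automatic when $\lambda<k$). Let $\mathbb{F}$ be a field of characteristic $0$. An $n$-dimensional matrix of order $v$ over $\mathbb{F}$ ($n\ge 2$) is a function $C:\{1,\ldots,v\}^n\to\mathbb{F}$. For $1\le x<y\le n$, the projection $\Pi_{xy}(C)$ is the $v\times v$ matrix whose $(i_x,i_y)$-entry is the sum (in $\mathbb{F}$) of $C(i_1,\ldots,i_n)$ over all $n$-tuples $(i_1,\ldots,i_n)\in\{1,\ldots,v\}^n$ with the coordinates $i_x$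 and $i_y$ fixed. A $(v,k,\lambda)$ projection $n$-cube is an $n$-dimensional matrix $C:\{1,\ldots,v\}^n\to\mathbb{F}$ with entries in $\{0,1\}$ such that all projections $\Pi_{xy}(C)$, $1\le x<y\le n$, are symmetric $(v,k,\lambda)$ designs. For such $C$, write $\overline{C}=\{(i_1,\ldots,i_n)\in\{1,\ldots,v\}^n\mid C(i_1,\ldots,i_n)=1\}$. For a subset $S\subseteq\{1,\ldots,v\}^n$ and $1\le x<y\le n$, the projection is $\Pi_{xy}(S)=\{(i_x,i_y)\mid (i_1,\ldots,i_n)\in S\}\subseteq\{1,\ldots,v\}^2$. *)

theory Defs
  imports "Jordan_Normal_Form.Matrix" "HOL-Library.FuncSet"
begin

text \<open>An \<open>n\<close>-tuple \<open>(i\<^sub>1, \<dots>, i\<^sub>n)\<close> over \<open>{1..v}\<close> is an extensional function on \<open>{1..n}\<close>.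
  Matrices of type \<^typ>\<open>'a mat\<close> are indexed from \<open>0\<close>, so row \<open>i\<close> and column \<open>j\<close>
  (with \<open>i, j < v\<close>) stand for the points \<open>Suc i\<close> and \<open>Suc j\<close> of \<open>{1..v}\<close>.\<close>

definition tuples :: "nat \<Rightarrow> nat \<Rightarrow> (nat \<Rightarrow> nat) set" where
  "tuples n v = {1..n} \<rightarrow>\<^sub>E {1..v}"

definition all_ones_mat :: "nat \<Rightarrow> 'a::one mat" where
  "all_ones_mat v = mat v v (\<lambda>_. 1)"

text \<open>The column condition follows from the other ones if \<open>\<lambda> < k\<close>, but not in general.
  The difference \<open>k - \<lambda>\<close> is taken in the field.\<close>

definition symmetric_design :: "nat \<Rightarrow> nat \<Rightarrow> nat \<Rightarrow> 'a::field_char_0 mat \<Rightarrow> bool" where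
  "symmetric_design v k l A \<longleftrightarrow>
     A \<in> carrier_mat v v \<and>
     elements_mat A \<subseteq> {0, 1} \<and>
     A * transpose_mat A = (of_nat k - of_nat l) \<cdot>\<^sub>m 1\<^sub>m v + of_nat l \<cdot>\<^sub>m all_ones_mat v \<and>
     (\<forall>j<v. card {i. i < v \<and> A $$ (i, j) = 1} = k)"

definition proj_mat ::
  "nat \<Rightarrow> nat \<Rightarrow> nat \<Rightarrow> nat \<Rightarrow> ((nat \<Rightarrow> nat) \<Rightarrow> 'a::field_char_0) \<Rightarrow> 'a mat" where
  "proj_mat n v x y C =
     mat v v (\<lambda>(i, j). \<Sum>t \<in> {t \<in> tuples n v. t x = Suc i \<and> t y = Suc j}. C t)"

definition projection_cube ::
  "nat \<Rightarrow> nat \<Rightarrow> nat \<Rightarrow> nat \<Rightarrow> ((nat \<Rightarrow> nat) \<Rightarrow> 'a::field_char_0) \<Rightarrow> bool" where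
  "projection_cube n v k l C \<longleftrightarrow>
     C \<in> tuples n v \<rightarrow>\<^sub>E {0, 1} \<and>
     (\<forall>x y. 1 \<le> x \<and> x < y \<and> y \<le> n \<longrightarrow> symmetric_design v k l (proj_mat n v x y C))"

definition cube_support ::
  "nat \<Rightarrow> nat \<Rightarrow> ((nat \<Rightarrow> nat) \<Rightarrow> 'a::field_char_0) \<Rightarrow> (nat \<Rightarrow> nat) set" where
  "cube_support n v C = {t \<in> tuples n v. C t = 1}"

definition proj_set :: "nat \<Rightarrow> nat \<Rightarrow> (nat \<Rightarrow> nat) set \<Rightarrow> (nat \<times> nat) set" where
  "proj_set x y S = {(t x, t y) | t. t \<in> S}"

end

theory Submission
  imports Defs
begin

text \<open>The entries of \<open>proj_mat n v x y C\<close> count the points of \<open>S = cube_support n v C\<close> in the fibres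
  of \<open>t \<mapsto> (t x, t y)\<close>.  If all fibres have at most one point, then the matrix is the incidence
  matrix of the relation \<open>proj_set x y S\<close>, and for such a matrix the conditions of a symmetric
  design are the conditions (1)--(3): the \<open>(i, i')\<close>-entry of \<open>A A\<^sup>t\<close> counts the columns in which
  both rows \<open>i\<close> and \<open>i'\<close> contain a one, so its diagonal gives the row sums and its other entries
  give \<open>\<lambda>\<close> (lemma \<open>symmetric_design_incidence_mat\<close>; characteristic \<open>0\<close> allows numbers to be
  compared in the field).

  It remains to see that the fibres have at most one point.  For a cube, this holds because the
  entries of the projection, which are the fibre sizes, are \<open>0\<close> or \<open>1\<close>.  Conversely, condition (1)
  shows that \<open>proj_set x y S\<close> has \<open>v k\<close> elements.  It is the image of \<open>S\<close>, which has \<open>v k\<close> elements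
  too, so \<open>t \<mapsto> (t x, t y)\<close> is injective on \<open>S\<close>.  The cube is then the indicator function of \<open>S\<close>.\<close>

section \<open>Designs as relations\<close>

definition relation_design :: "nat \<Rightarrow> nat \<Rightarrow> nat \<Rightarrow> (nat \<times> nat) set \<Rightarrow> bool" where
  "relation_design v k l P \<longleftrightarrow>
     (\<forall>i \<in> {1..v}. card {j \<in> {1..v}. (i, j) \<in> P} = k) \<and>
     (\<forall>j \<in> {1..v}. card {i \<in> {1..v}. (i, j) \<in> P} = k) \<and>
     (\<forall>i \<in> {1..v}. \<forall>i' \<in> {1..v}. i \<noteq> i' \<longrightarrow>
        card {j \<in> {1..v}. (i, j) \<in> P \<and> (i', j) \<in> P} = l)"

definition incidence_mat :: "nat \<Rightarrow> (nat \<times> nat) set \<Rightarrow> 'a::field_char_0 mat" where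
  "incidence_mat v P = mat v v (\<lambda>(i, j). of_bool ((Suc i, Suc j) \<in> P))"

lemma card_shift_Suc: "card {j. j < v \<and> Q (Suc j)} = card {j \<in> {1..v}. Q j}"
proof -
  have "{j \<in> {1..v}. Q j} = Suc ` {j. j < v \<and> Q (Suc j)}"
    by (auto simp: image_iff Suc_le_eq gr0_conv_Suc)
  then show ?thesis
    by (simp add: card_image)
qed

lemma ball_shift_Suc: "(\<forall>i<v. Q (Suc i)) \<longleftrightarrow> (\<forall>i \<in> {1..v}. Q i)"
  by (auto simp: Suc_le_eq gr0_conv_Suc)

lemma incidence_mat_gram:
  assumes "i < v" "i' < v"
  shows "(incidence_mat v P * transpose_mat (incidence_mat v P)) $$ (i, i') =
    (of_nat (card {j \<in> {1..v}. (Suc i, j) \<in> P \<and> (Suc i', j) \<in> P}) :: 'a::field_char_0)"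
proof -
  have "(incidence_mat v P * transpose_mat (incidence_mat v P)) $$ (i, i') =
      (\<Sum>j \<in> {0..<v}. of_bool ((Suc i, Suc j) \<in> P \<and> (Suc i', Suc j) \<in> P) :: 'a)"
    using assms by (auto simp: incidence_mat_def scalar_prod_def intro!: arg_cong[of _ _ card])
  also have "\<dots> = of_nat (card {j. j < v \<and> (Suc i, Suc j) \<in> P \<and> (Suc i', Suc j) \<in> P})"
    by (subst sum_of_bool_eq) (auto intro: arg_cong[of _ _ card])
  finally show ?thesis
    using card_shift_Suc[of v "\<lambda>j. (Suc i, j) \<in> P \<and> (Suc i', j) \<in> P"] by simp
qed

text \<open>On the diagonal, the two field elements \<open>k - \<lambda>\<close> and \<open>\<lambda>\<close> add up to \<open>k\<close>, also if \<open>k < \<lambda>\<close>; this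
  is why the equation for \<open>A A\<^sup>t\<close> contains condition (1).\<close>

lemma symmetric_design_incidence_mat:
  "symmetric_design v k l (incidence_mat v P :: 'a::field_char_0 mat) \<longleftrightarrow> relation_design v k l P"
proof -
  let ?A = "incidence_mat v P :: 'a mat"
  let ?c = "\<lambda>i i'. card {j \<in> {1..v}. (i, j) \<in> P \<and> (i', j) \<in> P}"
  have carrier: "?A \<in> carrier_mat v v"
    by (simp add: incidence_mat_def)
  have elements: "elements_mat ?A \<subseteq> {0, 1}"
    by (auto simp: incidence_mat_def elements_mat_def)
  have columns: "(\<forall>j<v. card {i. i < v \<and> ?A $$ (i, j) = 1} = k) \<longleftrightarrow>
      (\<forall>j \<in> {1..v}. card {i \<in> {1..v}. (i, j) \<in> P} = k)"
  proof -
    have "card {i. i < v \<and> ?A $$ (i, j) = 1} = card {i \<in> {1..v}. (i, Suc j) \<in> P}" if "j < v" for j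
    proof -
      have "{i. i < v \<and> ?A $$ (i, j) = 1} = {i. i < v \<and> (Suc i, Suc j) \<in> P}"
        using that by (auto simp: incidence_mat_def)
      then show ?thesis
        using card_shift_Suc[of v "\<lambda>i. (i, Suc j) \<in> P"] by simp
    qed
    then show ?thesis
      unfolding ball_shift_Suc[symmetric] by simp
  qed
  have "?A * transpose_mat ?A = (of_nat k - of_nat l) \<cdot>\<^sub>m 1\<^sub>m v + of_nat l \<cdot>\<^sub>m all_ones_mat v \<longleftrightarrow>
      (\<forall>i<v. \<forall>i'<v. (?A * transpose_mat ?A) $$ (i, i') = (if i = i' then of_nat k else of_nat l))"
    using carrier by (auto simp: mat_eq_iff all_ones_mat_def)
  also have "\<dots> \<longleftrightarrow> (\<forall>i<v. \<forall>i'<v. ?c (Suc i) (Suc i') = (if Suc i = Suc i' then k else l))"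
    by (simp add: incidence_mat_gram if_distrib[of of_nat, symmetric] del: index_mult_mat)
  also have "\<dots> \<longleftrightarrow> (\<forall>i \<in> {1..v}. \<forall>i' \<in> {1..v}. ?c i i' = (if i = i' then k else l))"
    unfolding ball_shift_Suc[of v "\<lambda>i'. ?c _ i' = (if _ = i' then k else l)"]
      ball_shift_Suc[of v "\<lambda>i. \<forall>i' \<in> {1..v}. ?c i i' = (if i = i' then k else l)"] ..
  finally have "?A * transpose_mat ?A = (of_nat k - of_nat l) \<cdot>\<^sub>m 1\<^sub>m v + of_nat l \<cdot>\<^sub>m all_ones_mat v \<longleftrightarrow>
      (\<forall>i \<in> {1..v}. \<forall>i' \<in> {1..v}. ?c i i' = (if i = i' then k else l))" .
  moreover have "\<dots> \<longleftrightarrow> (\<forall>i \<in> {1..v}. card {j \<in> {1..v}. (i, j) \<in> P} = k) \<and>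
      (\<forall>i \<in> {1..v}. \<forall>i' \<in> {1..v}. i \<noteq> i' \<longrightarrow> ?c i i' = l)"
    by fastforce
  ultimately show ?thesis
    unfolding symmetric_design_def relation_design_def columns using carrier elements by blast
qed

section \<open>Projections and fibres\<close>

lemma finite_tuples: "finite (tuples n v)"
  by (simp add: tuples_def finite_PiE)

lemma proj_set_conv_image: "proj_set x y S = (\<lambda>t. (t x, t y)) ` S"
  by (auto simp: proj_set_def)

lemma proj_mat_entry:
  assumes C: "C \<in> tuples n v \<rightarrow>\<^sub>E {0, 1 :: 'a::field_char_0}" and "i < v" "j < v"
  shows "proj_mat n v x y C $$ (i, j) =
    of_nat (card {t \<in> cube_support n v C. (t x, t y) = (Suc i, Suc j)})"
proof -
  let ?T = "{t \<in> tuples n v. t x = Suc i \<and> t y = Suc j}"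
  have "proj_mat n v x y C $$ (i, j) = (\<Sum>t \<in> ?T. C t)"
    using assms by (simp add: proj_mat_def)
  also have "\<dots> = (\<Sum>t \<in> ?T. if C t = 1 then 1 else 0)"
    using C by (intro sum.cong) (auto dest: PiE_mem)
  also have "\<dots> = of_nat (card (?T \<inter> {t. C t = 1}))"
    using finite_tuples[of n v] by (simp add: sum.If_cases)
  also have "?T \<inter> {t. C t = 1} = {t \<in> cube_support n v C. (t x, t y) = (Suc i, Suc j)}"
    by (auto simp: cube_support_def)
  finally show ?thesis .
qed

text \<open>An entry of the incidence matrix tells whether a fibre is nonempty, an entry of \<open>proj_mat\<close>
  gives the size of the fibre.  They agree as soon as the fibre has size at most one.\<close>

lemma proj_mat_eq_incidence_mat:
  assumes C: "C \<in> tuples n v \<rightarrow>\<^sub>E {0, 1 :: 'a::field_char_0}"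
    and small: "\<And>i j. i < v \<Longrightarrow> j < v \<Longrightarrow>
      card {t \<in> cube_support n v C. (t x, t y) = (Suc i, Suc j)} \<le> 1"
  shows "proj_mat n v x y C = incidence_mat v (proj_set x y (cube_support n v C))"
proof (rule eq_matI)
  fix i j
  assume "i < dim_row (incidence_mat v (proj_set x y (cube_support n v C)) :: 'a mat)"
    and "j < dim_col (incidence_mat v (proj_set x y (cube_support n v C)) :: 'a mat)"
  then have ij: "i < v" "j < v"
    by (simp_all add: incidence_mat_def)
  let ?F = "{t \<in> cube_support n v C. (t x, t y) = (Suc i, Suc j)}"
  have "finite ?F"
    using finite_tuples[of n v] by (simp add: cube_support_def)
  then have nonempty: "card ?F \<noteq> 0 \<longleftrightarrow> ?F \<noteq> {}"
    by (simp only: card_0_eq simp_thms)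
  have "card ?F = of_bool (card ?F \<noteq> 0)"
    using small[OF ij] by (simp only: of_bool_def split: if_split) linarith
  also note nonempty
  also have "?F \<noteq> {} \<longleftrightarrow> (Suc i, Suc j) \<in> proj_set x y (cube_support n v C)"
    by (auto simp: proj_set_def) metis
  finally show "proj_mat n v x y C $$ (i, j) =
      incidence_mat v (proj_set x y (cube_support n v C)) $$ (i, j)"
    using ij by (simp add: proj_mat_entry[OF C ij] incidence_mat_def del: prod.inject)
qed (simp_all add: proj_mat_def incidence_mat_def)

text \<open>The fibre sizes are natural numbers, and by characteristic \<open>0\<close> only \<open>0\<close> and \<open>1\<close> become the
  field elements \<open>0\<close> and \<open>1\<close>.\<close>

lemma fibre_card_le_1_if_entries_0_1:
  assumes C: "C \<in> tuples n v \<rightarrow>\<^sub>E {0, 1 :: 'a::field_char_0}"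
    and elements: "elements_mat (proj_mat n v x y C) \<subseteq> {0, 1}" and ij: "i < v" "j < v"
  shows "card {t \<in> cube_support n v C. (t x, t y) = (Suc i, Suc j)} \<le> 1" (is "card ?F \<le> 1")
proof -
  have "proj_mat n v x y C $$ (i, j) \<in> elements_mat (proj_mat n v x y C)"
    using ij by (intro elements_matI[OF _ ij refl]) (simp add: proj_mat_def)
  then have "(of_nat (card ?F) :: 'a) \<in> {0, 1}"
    using elements proj_mat_entry[OF C ij, of x y] by auto
  then show ?thesis
    by (auto simp del: prod.inject)
qed

lemma fibre_card_le_1_if_inj_on:
  assumes "inj_on f S"
  shows "card {t \<in> S. f t = b} \<le> 1"
proof -
  have "{t \<in> S. f t = b} = f -` {b} \<inter> S"
    by auto
  then show ?thesis
    using card_vimage_inj_on_le[OF assms, of "{b}"] by simp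
qed

lemma card_relation_constant_rows:
  assumes P: "P \<subseteq> {1..v} \<times> {1..v}"
    and rows: "\<And>i. i \<in> {1..v} \<Longrightarrow> card {j \<in> {1..v}. (i, j) \<in> P} = k"
  shows "card P = v * k"
proof -
  have "P = Sigma {1..v} (\<lambda>i. {j \<in> {1..v}. (i, j) \<in> P})"
    using P by auto
  then have "card P = card (Sigma {1..v} (\<lambda>i. {j \<in> {1..v}. (i, j) \<in> P}))"
    by (rule arg_cong)
  also have "\<dots> = (\<Sum>i \<in> {1..v}. card {j \<in> {1..v}. (i, j) \<in> P})"
    by (rule card_SigmaI) simp_all
  also have "\<dots> = v * k"
    using rows by simp
  finally show ?thesis .
qed

text \<open>A map on a finite set is injective if its image has as many elements as the set.  This is
  where the hypothesis \<open>card S = v * k\<close> enters: conditions (1)--(3) only see the image, not how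
  often its elements are attained.\<close>

lemma inj_on_proj_if_relation_design:
  assumes S: "S \<subseteq> tuples n v" "card S = v * k" and xy: "1 \<le> x" "x < y" "y \<le> n"
    and design: "relation_design v k l (proj_set x y S)"
  shows "inj_on (\<lambda>t. (t x, t y)) S"
proof (rule eq_card_imp_inj_on)
  show "finite S"
    using S finite_tuples finite_subset by blast
  have "proj_set x y S \<subseteq> {1..v} \<times> {1..v}"
    using S xy by (fastforce simp: proj_set_def tuples_def dest: PiE_mem)
  then have "card (proj_set x y S) = v * k"
    using design by (intro card_relation_constant_rows) (auto simp: relation_design_def)
  then show "card ((\<lambda>t. (t x, t y)) ` S) = card S"
    using S by (simp add: proj_set_conv_image)
qed

section \<open>The characterisation of projection cubes\<close>

theorem proposition2p4:
  fixes n v k l :: nat and S :: "(nat \<Rightarrow> nat) set"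
  assumes "2 \<le> n" and "S \<subseteq> tuples n v" and "card S = v * k"
  shows "(\<exists>C :: (nat \<Rightarrow> nat) \<Rightarrow> 'f::field_char_0.
            projection_cube n v k l C \<and> S = cube_support n v C) \<longleftrightarrow>
         (\<forall>x y. 1 \<le> x \<and> x < y \<and> y \<le> n \<longrightarrow>
            (\<forall>i \<in> {1..v}. card {j \<in> {1..v}. (i, j) \<in> proj_set x y S} = k) \<and>
            (\<forall>j \<in> {1..v}. card {i \<in> {1..v}. (i, j) \<in> proj_set x y S} = k) \<and>
            (\<forall>i \<in> {1..v}. \<forall>i' \<in> {1..v}. i \<noteq> i' \<longrightarrow>
               card {j \<in> {1..v}. (i, j) \<in> proj_set x y S \<and> (i', j) \<in> proj_set x y S} = l))"
  unfolding relation_design_def[symmetric]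
proof (intro iffI allI impI)
  fix x y
  assume "\<exists>C :: (nat \<Rightarrow> nat) \<Rightarrow> 'f. projection_cube n v k l C \<and> S = cube_support n v C"
    and xy: "1 \<le> x \<and> x < y \<and> y \<le> n"
  then obtain C :: "(nat \<Rightarrow> nat) \<Rightarrow> 'f" where C: "C \<in> tuples n v \<rightarrow>\<^sub>E {0, 1}"
    and S: "S = cube_support n v C" and design: "symmetric_design v k l (proj_mat n v x y C)"
    unfolding projection_cube_def by blast
  have "elements_mat (proj_mat n v x y C) \<subseteq> {0, 1}"
    using design by (simp add: symmetric_design_def)
  then have "proj_mat n v x y C = incidence_mat v (proj_set x y S)"
    unfolding S using C by (intro proj_mat_eq_incidence_mat fibre_card_le_1_if_entries_0_1)
  then show "relation_design v k l (proj_set x y S)"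
    using design by (simp add: symmetric_design_incidence_mat)
next
  assume design: "\<forall>x y. 1 \<le> x \<and> x < y \<and> y \<le> n \<longrightarrow> relation_design v k l (proj_set x y S)"
  define C :: "(nat \<Rightarrow> nat) \<Rightarrow> 'f" where "C = restrict (\<lambda>t. of_bool (t \<in> S)) (tuples n v)"
  have C: "C \<in> tuples n v \<rightarrow>\<^sub>E {0, 1}"
    by (auto simp: C_def)
  have S: "cube_support n v C = S"
    using assms(2) by (auto simp: C_def cube_support_def)
  have "symmetric_design v k l (proj_mat n v x y C)" if xy: "1 \<le> x \<and> x < y \<and> y \<le> n" for x y
  proof -
    have "inj_on (\<lambda>t. (t x, t y)) S"
      using assms(2,3) xy design by (intro inj_on_proj_if_relation_design) auto
    then have "proj_mat n v x y C = incidence_mat v (proj_set x y S)"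
      by (intro proj_mat_eq_incidence_mat[OF C, of x y, unfolded S] fibre_card_le_1_if_inj_on)
    then show ?thesis
      using xy design by (simp add: symmetric_design_incidence_mat)
  qed
  then have "projection_cube n v k l C"
    using C by (simp add: projection_cube_def)
  then show "\<exists>C :: (nat \<Rightarrow> nat) \<Rightarrow> 'f. projection_cube n v k l C \<and> S = cube_support n v C"
    using S by blast
qed

end
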